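(* Let $F(x,y)=Ax^2+2Bxy+Cy^2$ be an indefinite quadratic form (meaning $B^2-AC\geq 0$) with $A,B,C\in\mathbb{Z}_{\geq 0}$. Then there exist lattice polytopes $P,Q\subset\mathbb{R}^2$ such that $F(x,y)$ is the normalized volume polynomial of $P$ and $Q$, that is, $F(x,y)=\operatorname{Vol}_2(xP+yQ)$ for all real $x,y\geq 0$.
   Context: A binary quadratic form $ax^2+2bxy+cy^2$ is called indefinite if its discriminant $4(b^2-ac)$ is non-negative (equality is allowed). A lattice polytope in $\mathbb{R}^2$ is the convex hull of finitely many (at least one) points of $\mathbb{Z}^2$; it may be degenerate (a point or a segment). $\operatorname{Vol}_2$ denotes the normalized area, i.e. $2$ times the Euclidean area (Lebesgue measure) in $\mathbb{R}^2$. For $x,y\ge 0$, $xP+yQ=\{xp+yq : p\in P,\ q\in Q\}$ is the Minkowski combination. *)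

theory Defs
  imports "HOL-Analysis.Analysis"
begin

definition integer_points :: "(real^2) set" where
  "integer_points = {v. \<forall>i. v $ i \<in> \<int>}"

text \<open>The generating set is nonempty, so the empty set is not a lattice polytope;
  points and segments are allowed.\<close>

definition lattice_polytope :: "(real^2) set \<Rightarrow> bool" where
  "lattice_polytope P \<longleftrightarrow>
     (\<exists>V. finite V \<and> V \<noteq> {} \<and> V \<subseteq> integer_points \<and> P = convex hull V)"

definition normalized_area :: "(real^2) set \<Rightarrow> real" where
  "normalized_area S = 2 * measure lebesgue S"

definition minkowski_comb :: "real \<Rightarrow> (real^2) set \<Rightarrow> real \<Rightarrow> (real^2) set \<Rightarrow> (real^2) set" where
  "minkowski_comb x P y Q = {x *\<^sub>R p + y *\<^sub>R q | p q. p \<in> P \<and> q \<in> Q}"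

end

theory Submission
  imports Defs
begin

text \<open>
  Induct on A + B + C, assuming A \<le> C by symmetry; indefiniteness then gives A \<le> B. Replacing Q
  by Q + P turns the volume polynomial with coefficients (A, B - A, C - 2B + A) into the one with
  coefficients (A, B, C) and preserves the discriminant, so only two cases remain. If
  A + C \<le> 2B, put p = min(B, C) and k = B - A - (C - p) and take P with vertices
  (0,0), (A,0), (0,1) and Q with vertices (0,0), (p,0), (k,1), (B - A,1); both have height at
  most one, and the area of xP + yQ is found by integrating the lengths of its horizontal sections.
  If A = B = 0, take P to be a point.
\<close>

section \<open>Area between graphs\<close>

lemma measurable_vector_2:
  "(\<lambda>p. vector [fst p, snd p] :: real^2) \<in> borel_measurable borel"
proof -
  have "continuous_on UNIV (\<lambda>p :: real \<times> real. vector [fst p, snd p] :: real^2)"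
  proof (subst continuous_on_componentwise, intro ballI)
    fix i :: "real^2"
    assume "i \<in> Basis"
    then obtain k where i: "i = axis k 1"
      by (auto simp: Basis_vec_def)
    show "continuous_on UNIV (\<lambda>p :: real \<times> real. (vector [fst p, snd p] :: real^2) \<bullet> i)"
      unfolding i using exhaust_2[of k]
      by (elim disjE) (simp_all add: inner_axis continuous_on_fst continuous_on_snd)
  qed
  then show ?thesis
    by (rule borel_measurable_continuous_onI)
qed

text \<open>Lebesgue measure is determined by its values on boxes, and a box pulls back to a product
  of two intervals. This makes Tonelli's theorem available on \<open>real^2\<close>.\<close>

lemma lborel_vec2_eq_distr:
  "(lborel :: (real^2) measure) =
     distr (lborel \<Otimes>\<^sub>M lborel) borel (\<lambda>p. vector [fst p, snd p])"
proof (rule lborel_eqI)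
  fix l u :: "real^2"
  assume le: "\<And>b. b \<in> Basis \<Longrightarrow> l \<bullet> b \<le> u \<bullet> b"
  have le': "l $ i \<le> u $ i" for i
    using le[of "axis i 1"] by (simp add: inner_axis)
  have eq: "(\<lambda>p. vector [fst p, snd p]) -` box l u \<inter> space (lborel \<Otimes>\<^sub>M lborel) =
      {l$1<..<u$1} \<times> {l$2<..<u$2}"
    by (auto simp: mem_box_cart forall_2 space_pair_measure)
  have "emeasure (distr (lborel \<Otimes>\<^sub>M lborel) borel (\<lambda>p. vector [fst p, snd p])) (box l u)
      = emeasure (lborel \<Otimes>\<^sub>M lborel) ({l$1<..<u$1} \<times> {l$2<..<u$2})"
    using measurable_vector_2 eq
    by (subst emeasure_distr) (auto simp: lborel_prod)
  also have "\<dots> = ennreal (u$1 - l$1) * ennreal (u$2 - l$2)"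
    using le' by (subst lborel.emeasure_pair_measure_Times) auto
  also have "\<dots> = ennreal (\<Prod>i\<in>UNIV. (u - l) $ i)"
    using le' by (simp add: UNIV_2 ennreal_mult)
  also have "(\<Prod>i\<in>UNIV. (u - l) $ i) = (\<Prod>b\<in>Basis. (u - l) \<bullet> b)"
    by (simp add: Basis_vec_def UNION_singleton_eq_range prod.reindex inj_on_def axis_eq_axis
        inner_axis del: vector_minus_component)
  finally show "emeasure (distr (lborel \<Otimes>\<^sub>M lborel) borel (\<lambda>p. vector [fst p, snd p])) (box l u)
      = (\<Prod>b\<in>Basis. (u - l) \<bullet> b)" .
qed simp

text \<open>Tonelli with the second coordinate as outer variable: the section at height
  \<open>t\<close> is the interval from \<open>l t\<close> to \<open>r t\<close>.\<close>

lemma measure_between_graphs: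
  fixes l r :: "real \<Rightarrow> real"
  assumes cont: "continuous_on UNIV l" "continuous_on UNIV r"
    and le: "\<And>t. t \<in> {a..b} \<Longrightarrow> l t \<le> r t"
    and int: "((\<lambda>t. r t - l t) has_integral I) {a..b}"
  shows "measure lebesgue {v :: real^2. v$2 \<in> {a..b} \<and> l (v$2) \<le> v$1 \<and> v$1 \<le> r (v$2)} = I"
    (is "measure lebesgue ?S = I")
proof -
  \<comment> \<open>Continuity makes the region closed, hence Borel, so its Lebesgue measure can be
    computed with \<open>lborel\<close>.\<close>
  have "closed ?S"
    using cont unfolding atLeastAtMost_iff
    by (intro closed_Collect_conj closed_Collect_le continuous_intros
        continuous_on_compose2[OF cont(1)] continuous_on_compose2[OF cont(2)]) auto
  then have S: "?S \<in> sets borel"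
    by simp
  let ?f = "\<lambda>p. vector [fst p, snd p] :: real^2"
  let ?T = "?f -` ?S \<inter> space (lborel \<Otimes>\<^sub>M lborel)"
  have T: "?T \<in> sets (lborel \<Otimes>\<^sub>M lborel)"
    using measurable_sets[OF measurable_vector_2 S] by (simp only: lborel_prod sets_lborel space_lborel space_borel)
  have "emeasure lborel ?S = emeasure (lborel \<Otimes>\<^sub>M lborel) ?T"
    by (subst lborel_vec2_eq_distr, rule emeasure_distr[OF _ S])
       (simp add: lborel_prod measurable_vector_2)
  also have "\<dots> = (\<integral>\<^sup>+t. emeasure lborel ((\<lambda>s. (s, t)) -` ?T) \<partial>lborel)"
    by (rule lborel_pair.emeasure_pair_measure_alt2[OF T])
  also have "\<dots> = (\<integral>\<^sup>+t. ennreal (indicator {a..b} t * (r t - l t)) \<partial>lborel)"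
  proof (rule nn_integral_cong)
    fix t :: real
    have "(\<lambda>s. (s, t)) -` ?T = (if t \<in> {a..b} then {l t..r t} else {})"
      by (auto simp: space_pair_measure)
    then show "emeasure lborel ((\<lambda>s. (s, t)) -` ?T) = ennreal (indicator {a..b} t * (r t - l t))"
      using le[of t] by auto
  qed
  also have "\<dots> = ennreal I"
    using nn_integral_has_integral_lebesgue[OF _ int] le
    by (simp add: mult_ac)
  finally have "emeasure lborel ?S = ennreal I" .
  moreover have "0 \<le> I"
    using has_integral_nonneg[OF int] le by simp
  ultimately have "measure lborel ?S = I"
    by (simp add: measure_def)
  then show ?thesis
    using S by simp
qed

text \<open>The section lengths integrated below are affine in the height up to kinks of this kind;
  the integral is split at the kink.\<close>

lemma has_integral_pos_part_shift:
  fixes d e :: real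
  assumes "0 \<le> d" "d \<le> e"
  shows "((\<lambda>t. max 0 (t - d)) has_integral (e - d)\<^sup>2 / 2) {0..e}"
proof -
  have 1: "((\<lambda>t. max 0 (t - d)) has_integral 0) {0..d}"
    by (rule has_integral_is_0) auto
  have "((\<lambda>t. t - d) has_integral ((e - d)\<^sup>2 / 2 - (d - d)\<^sup>2 / 2)) {d..e}"
    using assms
    by (intro fundamental_theorem_of_calculus)
       (auto intro!: derivative_eq_intros simp flip: has_real_derivative_iff_has_vector_derivative)
  then have "((\<lambda>t. t - d) has_integral (e - d)\<^sup>2 / 2) {d..e}"
    by simp
  then have 2: "((\<lambda>t. max 0 (t - d)) has_integral (e - d)\<^sup>2 / 2) {d..e}"
    by (rule has_integral_eq[rotated]) simp
  show ?thesis
    using has_integral_combine[OF assms 1 2] by simp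
qed

section \<open>Minkowski combinations\<close>

lemma convex_minkowski_comb:
  assumes "convex P" "convex Q"
  shows "convex (minkowski_comb x P y Q)"
proof -
  have "minkowski_comb x P y Q = (\<lambda>p. x *\<^sub>R p) ` P + (\<lambda>q. y *\<^sub>R q) ` Q"
    unfolding minkowski_comb_def set_plus_def by blast
  then show ?thesis
    using assms by (simp add: convex_set_plus convex_scaling)
qed

lemma minkowski_comb_commute: "minkowski_comb x P y Q = minkowski_comb y Q x P"
  unfolding minkowski_comb_def by (metis (no_types, opaque_lifting) add.commute)

text \<open>Convexity gives \<open>x P + y P = (x + y) P\<close>, which absorbs the copy of
  \<open>P\<close> added to \<open>Q\<close>.\<close>

lemma minkowski_comb_set_plus:
  assumes "convex P" "x \<ge> 0" "y \<ge> 0"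
  shows "minkowski_comb x P y (Q + P) = minkowski_comb (x + y) P y Q"
proof (intro set_eqI iffI)
  fix v
  assume "v \<in> minkowski_comb x P y (Q + P)"
  then obtain p q p' where v: "v = x *\<^sub>R p + y *\<^sub>R (q + p')" "p \<in> P" "q \<in> Q" "p' \<in> P"
    unfolding minkowski_comb_def set_plus_def by blast
  \<comment> \<open>The witness is the mean of \<open>p\<close> and \<open>p'\<close> weighted by
    \<open>x\<close> and \<open>y\<close>. If \<open>x + y = 0\<close>, both weights vanish and any
    point of \<open>P\<close> serves.\<close>
  have "\<exists>p''\<in>P. x *\<^sub>R p + y *\<^sub>R p' = (x + y) *\<^sub>R p''"
  proof (cases "x + y = 0")
    case True
    then show ?thesis using assms v by (intro bexI[of _ p]) (auto simp: add_nonneg_eq_0_iff)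
  next
    case False
    with assms have pos: "x + y > 0" by simp
    have "(x / (x + y)) *\<^sub>R p + (y / (x + y)) *\<^sub>R p' \<in> P"
      using assms v pos by (intro convexD) (auto simp flip: add_divide_distrib)
    then show ?thesis
      using pos by (intro bexI) (auto simp: scaleR_add_right)
  qed
  then obtain p'' where "p'' \<in> P" "x *\<^sub>R p + y *\<^sub>R p' = (x + y) *\<^sub>R p''" by blast
  moreover from this have "v = (x + y) *\<^sub>R p'' + y *\<^sub>R q"
    using v by (simp add: scaleR_add_right flip: add.assoc)
  ultimately show "v \<in> minkowski_comb (x + y) P y Q"
    unfolding minkowski_comb_def using v by blast
next
  fix v
  assume "v \<in> minkowski_comb (x + y) P y Q"
  then obtain p q where "v = x *\<^sub>R p + y *\<^sub>R (q + p)" "p \<in> P" "q \<in> Q"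
    unfolding minkowski_comb_def by (auto simp: algebra_simps)
  then show "v \<in> minkowski_comb x P y (Q + P)"
    unfolding minkowski_comb_def set_plus_def by blast
qed

lemma lattice_polytope_convex: "lattice_polytope P \<Longrightarrow> convex P"
  unfolding lattice_polytope_def by auto

lemma lattice_polytope_set_plus:
  assumes "lattice_polytope P" "lattice_polytope Q"
  shows "lattice_polytope (P + Q)"
proof -
  obtain V W where V: "finite V" "V \<noteq> {}" "V \<subseteq> integer_points" "P = convex hull V"
    and W: "finite W" "W \<noteq> {}" "W \<subseteq> integer_points" "Q = convex hull W"
    using assms unfolding lattice_polytope_def by metis
  have "P + Q = convex hull (V + W)"
    using V W by (simp add: convex_hull_set_plus)
  moreover have "finite (V + W)"
    using V W by (simp add: finite_set_plus)
  moreover have "V + W \<noteq> {}"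
    using V W unfolding set_plus_def by blast
  moreover have "v + w \<in> integer_points" if "v \<in> V" "w \<in> W" for v w
  proof -
    have "v \<in> integer_points" "w \<in> integer_points"
      using that V W by blast+
    then show ?thesis
      by (simp add: integer_points_def)
  qed
  then have "V + W \<subseteq> integer_points"
    by (auto elim: set_plus_elim)
  ultimately show ?thesis
    unfolding lattice_polytope_def by blast
qed

section \<open>Horizontal trapezoids of height one\<close>

lemma convex_horizontal_segment:
  fixes S :: "(real^2) set"
  assumes "convex S" "vector [l, t] \<in> S" "vector [r, t] \<in> S" "l \<le> s" "s \<le> r"
  shows "vector [s, t] \<in> S"
proof -
  have "s \<in> closed_segment l r"
    using assms by (simp add: closed_segment_eq_real_ivl)
  then obtain u where u: "0 \<le> u" "u \<le> 1" "s = (1 - u) * l + u * r"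
    unfolding closed_segment_def by auto
  have "(1 - u) *\<^sub>R vector [l, t] + u *\<^sub>R vector [r, t] \<in> S"
    using u assms by (intro convexD) auto
  then show ?thesis
    by (rule back_subst[of "\<lambda>w. w \<in> S"]) (simp add: vec_eq_iff forall_2 u algebra_simps)
qed

text \<open>Coinciding vertices are allowed, so \<open>trapezoid 0 A 0 0\<close> is a triangle, or a
  segment when \<open>A = 0\<close>.\<close>

definition trapezoid :: "real \<Rightarrow> real \<Rightarrow> real \<Rightarrow> real \<Rightarrow> (real^2) set" where
  "trapezoid a b c d = convex hull {vector [a, 0], vector [b, 0], vector [c, 1], vector [d, 1]}"

lemma lattice_polytope_trapezoid:
  assumes "a \<in> \<int>" "b \<in> \<int>" "c \<in> \<int>" "d \<in> \<int>"
  shows "lattice_polytope (trapezoid a b c d)"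
  unfolding lattice_polytope_def trapezoid_def using assms
  by (intro exI[of _ "{vector [a, 0], vector [b, 0], vector [c, 1], vector [d, 1]}"])
     (auto simp: integer_points_def forall_2)

text \<open>The right side is an intersection of half-planes containing the four vertices.
  Conversely, a point at height \<open>t\<close> lies between the points of the two legs at that
  height.\<close>

lemma trapezoid_eq:
  assumes "a \<le> b" "c \<le> d"
  shows "trapezoid a b c d =
    {v. 0 \<le> v$2 \<and> v$2 \<le> 1 \<and> a + (c - a) * v$2 \<le> v$1 \<and> v$1 \<le> b + (d - b) * v$2}"
    (is "_ = ?T")
proof
  have T: "?T = {v. vector [0, -1] \<bullet> v \<le> 0} \<inter> {v. vector [0, 1] \<bullet> v \<le> 1} \<inter>
      {v. vector [-1, c - a] \<bullet> v \<le> -a} \<inter> {v. vector [1, b - d] \<bullet> v \<le> b}"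
    by (auto simp: inner_vec_def sum_2 algebra_simps)
  have "convex ?T"
    unfolding T by (intro convex_Int convex_halfspace_le)
  then show "trapezoid a b c d \<subseteq> ?T"
    unfolding trapezoid_def using assms by (intro hull_minimal) auto
next
  have cv: "convex (trapezoid a b c d)"
    by (simp add: trapezoid_def)
  have V: "vector [a, 0] \<in> trapezoid a b c d" "vector [b, 0] \<in> trapezoid a b c d"
      "vector [c, 1] \<in> trapezoid a b c d" "vector [d, 1] \<in> trapezoid a b c d"
    unfolding trapezoid_def by (auto intro: hull_inc)
  show "?T \<subseteq> trapezoid a b c d"
  proof
    fix v assume v: "v \<in> ?T"
    define t where "t = v$2"
    define L where "L = a + (c - a) * t"
    define R where "R = b + (d - b) * t"
    have t: "0 \<le> t" "t \<le> 1" and LR: "L \<le> v$1" "v$1 \<le> R"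
      using v by (auto simp: t_def L_def R_def)
    have 1: "(1 - t) *\<^sub>R vector [a, 0] + t *\<^sub>R vector [c, 1] \<in> trapezoid a b c d"
      using t V by (intro convexD[OF cv]) auto
    have 2: "(1 - t) *\<^sub>R vector [b, 0] + t *\<^sub>R vector [d, 1] \<in> trapezoid a b c d"
      using t V by (intro convexD[OF cv]) auto
    have L: "vector [L, t] \<in> trapezoid a b c d"
      using 1 by (rule back_subst[of "\<lambda>w. w \<in> _"]) (simp add: vec_eq_iff forall_2 L_def algebra_simps)
    have R: "vector [R, t] \<in> trapezoid a b c d"
      using 2 by (rule back_subst[of "\<lambda>w. w \<in> _"]) (simp add: vec_eq_iff forall_2 R_def algebra_simps)
    have "v = vector [v$1, t]"
      by (simp add: vec_eq_iff forall_2 t_def)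
    then show "v \<in> trapezoid a b c d"
      using convex_horizontal_segment[OF cv L R LR] by simp
  qed
qed


text \<open>Greedy choice of heights in two polygons of height one scaled by \<open>x\<close> and
  \<open>y\<close>: the first takes as much of \<open>t\<close> as it can, the second the
  rest.\<close>

lemma split_height:
  fixes t x y :: real
  assumes "0 \<le> t" "t \<le> x + y" "0 \<le> x" "0 \<le> y"
  obtains s u where "0 \<le> s" "s \<le> 1" "0 \<le> u" "u \<le> 1" "x * s = min t x" "y * u = max 0 (t - x)"
proof
  \<comment> \<open>If \<open>x = 0\<close>, the else branch applies; if \<open>y = 0\<close>, then
    \<open>t \<le> x\<close> and the numerator of \<open>?u\<close> is 0.\<close>
  let ?s = "if t < x then t / x else 1" and ?u = "max 0 (t - x) / y"
  show "0 \<le> ?s" "?s \<le> 1" "0 \<le> ?u" "?u \<le> 1"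
    using assms by (auto simp: divide_simps)
  show "x * ?s = min t x" "y * ?u = max 0 (t - x)"
    using assms by auto
qed

text \<open>With rising height the left edges of the two polygons have slopes 0 and
  \<open>k\<close>, the right edges \<open>-A\<close> and \<open>B - A - p\<close>. As
  \<open>0 \<le> k\<close> and \<open>p \<le> B\<close>, a section reaches furthest left when the
  height goes to the first polygon first, and furthest right when it goes to the second first. The
  positive parts are the heights left over.\<close>

lemma minkowski_comb_trapezoids:
  fixes A B p k x y :: real
  assumes "0 \<le> A" "0 \<le> k" "k \<le> B - A" "0 \<le> p" "p \<le> B" and x: "0 \<le> x" and y: "0 \<le> y"
  shows "minkowski_comb x (trapezoid 0 A 0 0) y (trapezoid 0 p k (B - A)) =
    {v. v$2 \<in> {0..x + y} \<and> k * max 0 (v$2 - x) \<le> v$1 \<and>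
        v$1 \<le> A * x + p * y + (B - A - p) * v$2 - (B - p) * max 0 (v$2 - y)}"
    (is "?M = ?S")
proof
  let ?P = "trapezoid 0 A 0 0" and ?Q = "trapezoid 0 p k (B - A)"
  have P: "?P = {v. 0 \<le> v$2 \<and> v$2 \<le> 1 \<and> 0 \<le> v$1 \<and> v$1 \<le> A - A * v$2}"
    using assms by (subst trapezoid_eq) (auto simp: algebra_simps)
  have Q: "?Q = {v. 0 \<le> v$2 \<and> v$2 \<le> 1 \<and> k * v$2 \<le> v$1 \<and> v$1 \<le> p + (B - A - p) * v$2}"
    using assms by (subst trapezoid_eq) (auto simp: algebra_simps)
  show "?M \<subseteq> ?S"
  proof
    fix v assume "v \<in> ?M"
    then obtain a b where v: "v = x *\<^sub>R a + y *\<^sub>R b" and ab: "a \<in> ?P" "b \<in> ?Q"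
      unfolding minkowski_comb_def by blast
    define s u where "s = a$2" and "u = b$2"
    have su: "0 \<le> s" "s \<le> 1" "0 \<le> u" "u \<le> 1" and v2: "v$2 = x * s + y * u"
      using ab by (auto simp: P Q s_def u_def v)
    have xs: "0 \<le> x * s" "x * s \<le> x" and yu: "0 \<le> y * u" "y * u \<le> y"
      using su x y by (auto simp: mult_left_le)
    have a: "0 \<le> x * a$1" "x * a$1 \<le> x * (A - A * s)"
      using ab x by (auto simp: P s_def intro!: mult_left_mono)
    have b: "y * (k * u) \<le> y * b$1" "y * b$1 \<le> y * (p + (B - A - p) * u)"
      using ab y by (auto simp: Q u_def intro!: mult_left_mono)
    have v1: "v$1 = x * a$1 + y * b$1"
      by (simp add: v)
    \<comment> \<open>The first polygon contributes height at most \<open>x\<close>, so the second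
      contributes at least \<open>v$2 - x\<close>; the next bound is the same with the roles
      exchanged.\<close>
    have "k * max 0 (v$2 - x) \<le> k * (y * u)"
      using xs yu assms by (intro mult_left_mono) (auto simp: v2)
    moreover have "(B - p) * max 0 (v$2 - y) \<le> (B - p) * (x * s)"
      using xs yu assms by (intro mult_left_mono) (auto simp: v2)
    ultimately show "v \<in> ?S"
      using xs yu a b unfolding v1 v2 by (auto simp: v1 v2 algebra_simps)
  qed
  txt \<open>By convexity it suffices to find the two extreme points of each horizontal section. For the
    left one the height is used up in P first, for the right one in Q first.\<close>
  show "?S \<subseteq> ?M"
  proof
    fix v assume v: "v \<in> ?S"
    define t where "t = v$2"
    define L where "L = k * max 0 (t - x)"
    define R where "R = A * x + p * y + (B - A - p) * t - (B - p) * max 0 (t - y)"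
    have t: "0 \<le> t" "t \<le> x + y" and LR: "L \<le> v$1" "v$1 \<le> R"
      using v by (auto simp: t_def L_def R_def)
    have in_comb: "vector [x * a1 + y * b1, x * s + y * u] \<in> ?M"
      if "vector [a1, s] \<in> ?P" "vector [b1, u] \<in> ?Q" for a1 b1 s u
      unfolding minkowski_comb_def using that
      by (intro CollectI exI[of _ "vector [a1, s]"] exI[of _ "vector [b1, u]"])
         (auto simp: vec_eq_iff forall_2)
    obtain s u where su: "0 \<le> s" "s \<le> 1" "0 \<le> u" "u \<le> 1"
        "x * s = min t x" "y * u = max 0 (t - x)"
      using split_height[OF t x y] .
    \<comment> \<open>The width of the second polygon at height \<open>z\<close> interpolates
      between its bottom width \<open>p\<close> and top width \<open>B - A - k\<close>.\<close>
    have ineq: "k * z \<le> p + (B - A - p) * z" if "0 \<le> z" "z \<le> 1" for z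
    proof -
      have "0 \<le> (1 - z) * p + z * (B - A - k)"
        using that assms by (intro add_nonneg_nonneg mult_nonneg_nonneg) auto
      then show ?thesis by (simp add: algebra_simps)
    qed
    have "vector [x * 0 + y * (k * u), x * s + y * u] \<in> ?M"
      using su ineq assms by (intro in_comb) (auto simp: P Q mult_left_le)
    moreover have "x * 0 + y * (k * u) = L" "x * s + y * u = t"
      using su by (auto simp: L_def algebra_simps)
    ultimately have L: "vector [L, t] \<in> ?M"
      by simp
    obtain u' s' where su': "0 \<le> u'" "u' \<le> 1" "0 \<le> s'" "s' \<le> 1"
        "y * u' = min t y" "x * s' = max 0 (t - y)"
      using split_height[OF t(1) _ y x] t by (auto simp: add.commute)
    have "vector [x * (A - A * s') + y * (p + (B - A - p) * u'), x * s' + y * u'] \<in> ?M"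
      using su' ineq assms by (intro in_comb) (auto simp: P Q mult_left_le)
    moreover have t': "x * s' + y * u' = t"
      using su' by auto
    moreover have "x * (A - A * s') + y * (p + (B - A - p) * u') =
        A * x + p * y + (B - A - p) * (x * s' + y * u') - (B - p) * (x * s')"
      by (simp add: algebra_simps)
    then have "x * (A - A * s') + y * (p + (B - A - p) * u') = R"
      unfolding t' by (simp add: R_def su')
    ultimately have R: "vector [R, t] \<in> ?M"
      by simp
    have "convex ?M"
      by (intro convex_minkowski_comb) (auto simp: trapezoid_def)
    from convex_horizontal_segment[OF this L R LR] have "vector [v$1, t] \<in> ?M" .
    moreover have "v = vector [v$1, t]"
      by (simp add: vec_eq_iff forall_2 t_def)
    ultimately show "v \<in> ?M"
      by simp
  qed
qed

text \<open>The mixed coefficient is independent of \<open>p\<close> and \<open>k\<close>, which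
  leaves them free to tune the last coefficient: the sum of the parallel sides \<open>p\<close> and
  \<open>B - A - k\<close> of the second polygon.\<close>

lemma normalized_area_trapezoids:
  fixes A B p k x y :: real
  assumes "0 \<le> A" "0 \<le> k" "k \<le> B - A" "0 \<le> p" "p \<le> B" and x: "0 \<le> x" and y: "0 \<le> y"
  shows "normalized_area (minkowski_comb x (trapezoid 0 A 0 0) y (trapezoid 0 p k (B - A))) =
    A * x\<^sup>2 + 2 * B * x * y + (B - A + p - k) * y\<^sup>2"
proof -
  define l where "l = (\<lambda>t. k * max 0 (t - x))"
  define r where "r = (\<lambda>t. A * x + p * y + (B - A - p) * t - (B - p) * max 0 (t - y))"
  define I where "I = (A * x + p * y) * (x + y) + (B - A - p) * ((x + y)\<^sup>2 / 2)
    - (B - p) * (x\<^sup>2 / 2) - k * (y\<^sup>2 / 2)"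
  have S: "minkowski_comb x (trapezoid 0 A 0 0) y (trapezoid 0 p k (B - A)) =
      {v. v$2 \<in> {0..x + y} \<and> l (v$2) \<le> v$1 \<and> v$1 \<le> r (v$2)}" (is "?M = _")
    unfolding l_def r_def using minkowski_comb_trapezoids[OF assms] .
  \<comment> \<open>The bounds are in order because the section at height \<open>t\<close> is
    nonempty: add a point of the left edge of the first polygon to one of the right edge of the
    second.\<close>
  have "l t \<le> r t" if t: "t \<in> {0..x + y}" for t
  proof -
    obtain s u where su: "0 \<le> s" "s \<le> 1" "0 \<le> u" "u \<le> 1"
        "x * s = min t x" "y * u = max 0 (t - x)"
      using split_height[of t x y] t x y by auto
    have "x *\<^sub>R vector [0, s] + y *\<^sub>R vector [p * (1 - u) + (B - A) * u, u] \<in> ?M"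
    proof -
      have "k * u \<le> (B - A) * u" "0 \<le> p * (1 - u)"
        using su assms by (auto intro: mult_right_mono)
      then have "vector [p * (1 - u) + (B - A) * u, u] \<in> trapezoid 0 p k (B - A)"
        using su assms by (subst trapezoid_eq) (auto simp: algebra_simps)
      moreover have "vector [0, s] \<in> trapezoid 0 A 0 0"
        using su assms by (subst trapezoid_eq) (auto simp: mult_left_le)
      ultimately show ?thesis
        unfolding minkowski_comb_def by blast
    qed
    moreover have "x * s + y * u = t"
      using su by auto
    ultimately show ?thesis
      unfolding S by auto
  qed
  moreover have "((\<lambda>t. r t - l t) has_integral I) {0..x + y}"
  proof -
    have "((\<lambda>t. A * x + p * y) has_integral (A * x + p * y) * (x + y)) {0..x + y}"
      using has_integral_const_real[of "A * x + p * y" 0 "x + y"] x y by (simp add: mult.commute)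
    moreover have "((\<lambda>t. t) has_integral (x + y)\<^sup>2 / 2) {0..x + y}"
      using ident_has_integral[of 0 "x + y"] x y by simp
    moreover have "((\<lambda>t. max 0 (t - y)) has_integral x\<^sup>2 / 2) {0..x + y}"
      using has_integral_pos_part_shift[of y "x + y"] x y by simp
    moreover have "((\<lambda>t. max 0 (t - x)) has_integral y\<^sup>2 / 2) {0..x + y}"
      using has_integral_pos_part_shift[of x "x + y"] x y by simp
    ultimately show ?thesis
      unfolding r_def l_def I_def
      by (intro has_integral_diff has_integral_add has_integral_mult_right)
  qed
  moreover have "continuous_on UNIV l" "continuous_on UNIV r"
    unfolding l_def r_def by (intro continuous_intros)+
  ultimately have "measure lebesgue ?M = I"
    unfolding S by (intro measure_between_graphs)
  then show ?thesis
    unfolding normalized_area_def I_def by (simp add: field_simps power2_eq_square)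
qed

section \<open>Reduction of the form\<close>

definition volume_polynomial :: "int \<Rightarrow> int \<Rightarrow> int \<Rightarrow> (real^2) set \<Rightarrow> (real^2) set \<Rightarrow> bool" where
  "volume_polynomial A B C P Q \<longleftrightarrow>
    (\<forall>x y :: real. x \<ge> 0 \<longrightarrow> y \<ge> 0 \<longrightarrow>
      of_int A * x\<^sup>2 + 2 * of_int B * x * y + of_int C * y\<^sup>2
        = normalized_area (minkowski_comb x P y Q))"

lemma volume_polynomial_swap:
  "volume_polynomial A B C P Q \<Longrightarrow> volume_polynomial C B A Q P"
  unfolding volume_polynomial_def
proof (intro allI impI)
  fix x y :: real
  assume "\<forall>x y :: real. x \<ge> 0 \<longrightarrow> y \<ge> 0 \<longrightarrow>
      of_int A * x\<^sup>2 + 2 * of_int B * x * y + of_int C * y\<^sup>2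
        = normalized_area (minkowski_comb x P y Q)" and "x \<ge> 0" "y \<ge> 0"
  then have "of_int A * y\<^sup>2 + 2 * of_int B * y * x + of_int C * x\<^sup>2
      = normalized_area (minkowski_comb y P x Q)"
    by blast
  then show "of_int C * x\<^sup>2 + 2 * of_int B * x * y + of_int A * y\<^sup>2
      = normalized_area (minkowski_comb x Q y P)"
    by (subst minkowski_comb_commute) (simp add: mult_ac)
qed

text \<open>Adding \<open>P\<close> to \<open>Q\<close> substitutes \<open>x + y\<close> for
  \<open>x\<close> in the form.\<close>

lemma volume_polynomial_shear:
  assumes "convex P" "volume_polynomial A (B - A) (C - 2 * B + A) P Q"
  shows "volume_polynomial A B C P (Q + P)"
  unfolding volume_polynomial_def
proof (intro allI impI)
  fix x y :: real
  assume xy: "x \<ge> 0" "y \<ge> 0"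
  then have "normalized_area (minkowski_comb x P y (Q + P)) =
      of_int A * (x + y)\<^sup>2 + 2 * of_int (B - A) * (x + y) * y + of_int (C - 2 * B + A) * y\<^sup>2"
    using assms by (simp add: minkowski_comb_set_plus volume_polynomial_def)
  then show "of_int A * x\<^sup>2 + 2 * of_int B * x * y + of_int C * y\<^sup>2 =
      normalized_area (minkowski_comb x P y (Q + P))"
    by (simp add: algebra_simps power2_eq_square)
qed

lemma exists_volume_polynomial_reduced:
  fixes A B C :: int
  assumes "0 \<le> A" "A \<le> B" "A \<le> C" "A + C \<le> 2 * B"
  shows "\<exists>P Q. lattice_polytope P \<and> lattice_polytope Q \<and> volume_polynomial A B C P Q"
proof -
  \<comment> \<open>The parallel sides of \<open>?Q\<close> must have total length \<open>C\<close>.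
    The bottom takes as much as \<open>p \<le> B\<close> permits, the top the remaining
    \<open>C - p\<close>. If \<open>B < C\<close>, then \<open>k = 2 * B - A - C\<close>,
    nonnegative by the last hypothesis.\<close>
  define p where "p = min B C"
  define k where "k = B - A - (C - p)"
  let ?P = "trapezoid 0 (of_int A) 0 0"
  let ?Q = "trapezoid 0 (of_int p) (of_int k) (of_int B - of_int A)"
  have "0 \<le> p" "p \<le> B" "0 \<le> k" "k \<le> B - A"
    using assms by (auto simp: p_def k_def)
  then have pk: "0 \<le> real_of_int p" "real_of_int p \<le> of_int B" "0 \<le> real_of_int k"
      "real_of_int k \<le> of_int B - of_int A"
    by linarith+
  have "real_of_int B - of_int A + of_int p - of_int k = of_int C"
    by (simp add: k_def)
  then have "volume_polynomial A B C ?P ?Q"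
    unfolding volume_polynomial_def using normalized_area_trapezoids[of "of_int A" "of_int k"] pk assms
    by simp
  then show ?thesis
    by (intro exI[of _ ?P] exI[of _ ?Q]) (auto intro!: lattice_polytope_trapezoid)
qed

text \<open>The shear fixes a form with \<open>A = B = 0\<close>, so the descent cannot treat it. A
  point paired with any lattice polytope of normalized area \<open>C\<close> works.\<close>

lemma exists_volume_polynomial_square:
  assumes "0 \<le> C"
  shows "\<exists>P Q. lattice_polytope P \<and> lattice_polytope Q \<and> volume_polynomial 0 0 C P Q"
proof -
  \<comment> \<open>The form with all coefficients \<open>C\<close> is already reduced; setting its
    second variable to 0 shows that \<open>P\<close> has normalized area \<open>C\<close>.\<close>
  obtain P Q where PQ: "lattice_polytope P" "lattice_polytope Q" "volume_polynomial C C C P Q"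
    using exists_volume_polynomial_reduced[of C C C] assms by auto
  have "Q \<noteq> {}"
    using PQ unfolding lattice_polytope_def by auto
  then have "minkowski_comb x {0} y P = minkowski_comb y P 0 Q" for x y
    unfolding minkowski_comb_def by auto
  moreover have "normalized_area (minkowski_comb y P 0 Q) = of_int C * y\<^sup>2" if "y \<ge> 0" for y
    using PQ(3)[unfolded volume_polynomial_def, rule_format, of y 0] that by simp
  ultimately have "volume_polynomial 0 0 C {0} P"
    unfolding volume_polynomial_def by simp
  moreover have "lattice_polytope {0}"
    unfolding lattice_polytope_def by (intro exI[of _ "{0}"]) (auto simp: integer_points_def)
  ultimately show ?thesis
    using PQ by blast
qed

lemma exists_volume_polynomial:
  fixes A B C :: int
  assumes "A \<ge> 0" "B \<ge> 0" "C \<ge> 0" "A * C \<le> B\<^sup>2"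
  shows "\<exists>P Q. lattice_polytope P \<and> lattice_polytope Q \<and> volume_polynomial A B C P Q"
  using assms
proof (induction "nat (A + B + C)" arbitrary: A B C rule: less_induct)
  case less
  \<comment> \<open>Stated for fresh \<open>A\<close> and \<open>C\<close>, so that it applies to
    both orders of the outer coefficients. Its assumption \<open>IH\<close> is the induction
    hypothesis for the sheared form, whose coefficient sum \<open>B + C'\<close> is smaller.\<close>
  have ordered: "\<exists>P Q. lattice_polytope P \<and> lattice_polytope Q \<and> volume_polynomial A B C P Q"
    if AC: "A \<le> C" "A \<ge> 0" "C \<ge> 0" "A * C \<le> B\<^sup>2"
      and IH: "\<And>C'. 0 \<le> C' \<Longrightarrow> C' < C \<Longrightarrow> A \<le> B \<Longrightarrow> 0 < B \<Longrightarrow> A * C' \<le> (B - A)\<^sup>2 \<Longrightarrow>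
        \<exists>P Q. lattice_polytope P \<and> lattice_polytope Q \<and> volume_polynomial A (B - A) C' P Q"
    for A C
  proof -
    have "A * A \<le> A * C"
      using AC by (intro mult_left_mono)
    then have "A\<^sup>2 \<le> B\<^sup>2"
      using AC by (simp add: power2_eq_square)
    then have AB: "A \<le> B"
      using less.prems(2) by (rule power2_le_imp_le)
    \<comment> \<open>Reduced form, terminal form (\<open>B = 0\<close> forces
      \<open>A = 0\<close>), or a descent step.\<close>
    consider "A + C \<le> 2 * B" | "2 * B < A + C" "B = 0" | "2 * B < A + C" "0 < B"
      using less.prems by linarith
    then show ?thesis
    proof cases
      case 1
      then show ?thesis
        using exists_volume_polynomial_reduced AB AC by blast
    next
      case 2
      then show ?thesis
        using exists_volume_polynomial_square AB AC by auto
    next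
      case 3
      \<comment> \<open>The shear preserves \<open>B\<^sup>2 - A * C\<close>. The new last
        coefficient is positive by \<open>2 * B < A + C\<close>, and below \<open>C\<close> because
        \<open>A \<le> B < 2 * B\<close>.\<close>
      have "A * (C - 2 * B + A) \<le> (B - A)\<^sup>2"
        using AC by (simp add: power2_eq_square algebra_simps)
      then obtain P Q where PQ: "lattice_polytope P" "lattice_polytope Q"
          "volume_polynomial A (B - A) (C - 2 * B + A) P Q"
        using IH[of "C - 2 * B + A"] 3 AB by auto
      then show ?thesis
        using volume_polynomial_shear lattice_polytope_set_plus lattice_polytope_convex by metis
    qed
  qed
  show ?case
  proof (cases "A \<le> C")
    case True
    show ?thesis
    proof (rule ordered)
      fix C'
      assume "0 \<le> C'" "C' < C" "A \<le> B" "0 < B" "A * C' \<le> (B - A)\<^sup>2"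
      then show "\<exists>P Q. lattice_polytope P \<and> lattice_polytope Q \<and> volume_polynomial A (B - A) C' P Q"
        using less.prems by (intro less.hyps) auto
    qed (use less.prems True in auto)
  next
    case False
    have "\<exists>P Q. lattice_polytope P \<and> lattice_polytope Q \<and> volume_polynomial C B A P Q"
    proof (intro ordered)
      fix A'
      assume "0 \<le> A'" "A' < A" "C \<le> B" "0 < B" "C * A' \<le> (B - C)\<^sup>2"
      then show "\<exists>P Q. lattice_polytope P \<and> lattice_polytope Q \<and> volume_polynomial C (B - C) A' P Q"
        using less.prems by (intro less.hyps) auto
    qed (use less.prems False in \<open>auto simp: mult.commute\<close>)
    then show ?thesis
      using volume_polynomial_swap by blast
  qed
qed

theorem theorem4p2:
  fixes A B C :: int
  assumes "A \<ge> 0" and "B \<ge> 0" and "C \<ge> 0"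
    and indefinite: "B\<^sup>2 - A * C \<ge> 0"
  shows "\<exists>P Q :: (real^2) set. lattice_polytope P \<and> lattice_polytope Q \<and>
    (\<forall>x y :: real. x \<ge> 0 \<longrightarrow> y \<ge> 0 \<longrightarrow>
      of_int A * x\<^sup>2 + 2 * of_int B * x * y + of_int C * y\<^sup>2
        = normalized_area (minkowski_comb x P y Q))"
  using exists_volume_polynomial[of A B C] assms unfolding volume_polynomial_def by auto

end
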